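(* Let $T$ be a triangulation of some surface such that all its vertices except two have even degree, and let $x$ and $y$ be the two vertices of odd degree. If $c$ is a local $4$-coloring of $T$, then $c(x)=c(y)$, and the set of three colors used on the neighbors of $x$ is the same as the set of three colors used on the neighbors of $y$. In particular, if $x$ and $y$ are adjacent, then $T$ has local chromatic number at least five.
   Context: A surface is a compact connected 2-manifold without boundary. A triangulation of a surface is a (finite) graph embedded on the surface with all faces being triangles. For a vertex $v$ of a graph $G$, $N(v)$ denotes the set of vertices adjacent to $v$. For an integer $k\ge 1$, a proper vertex-coloring $c$ of $G$ is a local $k$-coloring if $|c(N(v))|\le k-1$ for every vertex $v$ of $G$ (the total number of colors used is not restricted). The local chromatic number of $G$ is the smallest $k$ such that $G$ has a local $k$-coloring. *)

theory Defs
  imports "HOL-Analysis.Analysis"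
begin

section \<open>Local colorings\<close>

text \<open>A graph is given by its vertex set \<open>V\<close> and its adjacency relation \<open>adj\<close>.\<close>

definition nbrs :: "'a set \<Rightarrow> ('a \<Rightarrow> 'a \<Rightarrow> bool) \<Rightarrow> 'a \<Rightarrow> 'a set" where
  "nbrs V adj v = {u \<in> V. adj v u}"

definition proper_coloring :: "'a set \<Rightarrow> ('a \<Rightarrow> 'a \<Rightarrow> bool) \<Rightarrow> ('a \<Rightarrow> 'c) \<Rightarrow> bool" where
  "proper_coloring V adj c \<longleftrightarrow> (\<forall>u\<in>V. \<forall>v\<in>V. adj u v \<longrightarrow> c u \<noteq> c v)"

definition local_coloring ::
  "'a set \<Rightarrow> ('a \<Rightarrow> 'a \<Rightarrow> bool) \<Rightarrow> nat \<Rightarrow> ('a \<Rightarrow> 'c) \<Rightarrow> bool" where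
  "local_coloring V adj k c \<longleftrightarrow>
     1 \<le> k \<and> proper_coloring V adj c \<and> (\<forall>v\<in>V. card (c ` nbrs V adj v) \<le> k - 1)"

text \<open>Natural numbers suffice as colors because only finite graphs are considered. A finite graph
  without loops always has a local coloring for some \<open>k\<close>, so the minimum exists.\<close>

definition local_chromatic_number :: "'a set \<Rightarrow> ('a \<Rightarrow> 'a \<Rightarrow> bool) \<Rightarrow> nat" where
  "local_chromatic_number V adj = (LEAST k. \<exists>c :: 'a \<Rightarrow> nat. local_coloring V adj k c)"


section \<open>Surfaces and embedded graphs\<close>

definition surface :: "'a topology \<Rightarrow> bool" where
  "surface S \<longleftrightarrow>
     topspace S \<noteq> {} \<and> compact_space S \<and> connected_space S \<and>
     Hausdorff_space S \<and> second_countable S \<and>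
     (\<forall>p\<in>topspace S. \<exists>U. openin S U \<and> p \<in> U \<and>
        subtopology S U homeomorphic_space (euclidean :: (real^2) topology))"

text \<open>\<open>joins S e u v\<close>: the point set \<open>e\<close> is a simple arc in \<open>S\<close> with ends \<open>u\<close> and \<open>v\<close>; in
  particular \<open>u \<noteq> v\<close>.\<close>

definition joins :: "'a topology \<Rightarrow> 'a set \<Rightarrow> 'a \<Rightarrow> 'a \<Rightarrow> bool" where
  "joins S e u v \<longleftrightarrow>
     (\<exists>g. embedding_map (top_of_set {0..1::real}) S g \<and> g ` {0..1} = e \<and> g 0 = u \<and> g 1 = v)"

text \<open>The vertices of an embedded graph are points of \<open>S\<close> and its edges are arcs in \<open>S\<close> that
  meet only in common ends. Loops are excluded (no graph with a loop has a proper coloring), but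
  several edges may join the same two vertices.\<close>

definition embedded_graph :: "'a topology \<Rightarrow> 'a set \<Rightarrow> 'a set set \<Rightarrow> bool" where
  "embedded_graph S V E \<longleftrightarrow>
     finite V \<and> V \<subseteq> topspace S \<and> finite E \<and>
     (\<forall>e\<in>E. \<exists>u\<in>V. \<exists>v\<in>V. joins S e u v \<and> e \<inter> V = {u, v}) \<and>
     (\<forall>e\<in>E. \<forall>f\<in>E. e \<noteq> f \<longrightarrow> e \<inter> f \<subseteq> V)"

definition adjacent :: "'a topology \<Rightarrow> 'a set set \<Rightarrow> 'a \<Rightarrow> 'a \<Rightarrow> bool" where
  "adjacent S E u v \<longleftrightarrow> (\<exists>e\<in>E. joins S e u v)"

text \<open>An edge contains no vertices other than its two ends, so for a vertex \<open>v\<close> the condition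
  \<open>v \<in> e\<close> says that \<open>e\<close> is incident with \<open>v\<close>.\<close>

definition edge_degree :: "'a set set \<Rightarrow> 'a \<Rightarrow> nat" where
  "edge_degree E v = card {e \<in> E. v \<in> e}"

definition faces :: "'a topology \<Rightarrow> 'a set \<Rightarrow> 'a set set \<Rightarrow> 'a set set" where
  "faces S V E = connected_components_of (subtopology S (topspace S - (V \<union> \<Union>E)))"

text \<open>A face is a triangle if it is the interior of a closed disc whose bounding circle is a
  3-cycle of the graph. It would not be enough to ask for an open disc whose frontier is the point
  set of a 3-cycle: a noncontractible 3-cycle in the projective plane has a single face, which is
  an open disc with that frontier, but whose boundary walk has length six.\<close>

definition triangular_face :: "'a topology \<Rightarrow> 'a set \<Rightarrow> 'a set set \<Rightarrow> 'a set \<Rightarrow> bool" where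
  "triangular_face S V E F \<longleftrightarrow>
     (\<exists>u\<in>V. \<exists>v\<in>V. \<exists>w\<in>V. \<exists>e\<in>E. \<exists>f\<in>E. \<exists>g\<in>E.
        joins S e u v \<and> joins S f v w \<and> joins S g w u \<and>
        (\<exists>h. embedding_map (top_of_set (cball (0::real^2) 1)) S h \<and>
             h ` ball 0 1 = F \<and> h ` sphere 0 1 = e \<union> f \<union> g))"

definition surface_triangulation :: "'a topology \<Rightarrow> 'a set \<Rightarrow> 'a set set \<Rightarrow> bool" where
  "surface_triangulation S V E \<longleftrightarrow>
     surface S \<and> embedded_graph S V E \<and> (\<forall>F\<in>faces S V E. triangular_face S V E F)"

end

theory Submission
  imports Defs
begin

text \<open>
  Give every vertex \<open>v\<close> its palette, the set of the colors of \<open>v\<close> and of its neighbors; in a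
  local 4-coloring a palette has at most four colors. Each edge lies on exactly two triangles, and
  everything else is parity counting with this fact.

  At a vertex \<open>v\<close> the number of triangles containing \<open>v\<close> and a given color \<open>b\<close> other than that of
  \<open>v\<close> is even, because each of them has one side from \<open>v\<close> to a vertex of color \<open>b\<close>, and each such
  edge is a side of two triangles. The number of all triangles at \<open>v\<close> is the degree of \<open>v\<close>. Hence, if
  \<open>v\<close> has a palette \<open>Q\<close> of four colors, then for each \<open>b\<close> in \<open>Q\<close> other than the color of \<open>v\<close> the number
  of triangles at \<open>v\<close> with color set \<open>Q - {b}\<close> has the parity of the degree of \<open>v\<close> (lemma \<open>parity_triangles_at_vertex\<close>); and an odd vertex must have four
  colors in its palette.

  Next, fix a set \<open>Q\<close> of four colors, a set \<open>P\<close> of three of them and two colors \<open>a\<close>, \<open>a'\<close> in \<open>P\<close>, and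
  look at the triangles with color set \<open>P\<close> whose corner of color \<open>a\<close> has palette \<open>Q\<close>. The parity of
  their number does not change if \<open>a\<close> is replaced by \<open>a'\<close>: a triangle that is counted only once has a
  side of colors \<open>a\<close>, \<open>a'\<close> with exactly one end of palette \<open>Q\<close>, and the two triangles at such a side
  must have the same color set, since otherwise both ends would see the same four colors. So these
  triangles come in pairs (lemma \<open>even_mixed_triangles\<close>).

  Together: for each \<open>Q\<close> the number of odd vertices with color \<open>a\<close> and palette \<open>Q\<close> has the same
  parity for all four colors \<open>a\<close> in \<open>Q\<close> (lemma \<open>parity_odd_vertices_eq\<close>). If there are only two odd
  vertices and they differed in color or palette, then each of the four colors would have an odd,
  hence positive, number of them.

  It remains to see that an edge of a triangulated surface is on exactly two faces (lemma
  \<open>exactly_two_faces\<close>). Two closed faces with a common edge, glued radially along it, give an injective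
  continuous map of an open subset of the plane into the surface. By invariance of domain the image is
  a neighborhood of the interior of the edge, so that there is no room for a third face. If there were only
  one face, or none, then a point of a surface would have a neighborhood that embeds into a closed disc
  with the point on the bounding circle, or a neighborhood that embeds into a segment, and both
  contradict invariance of domain.
\<close>

section \<open>Parity counts in complexes of triangles\<close>

lemma even_card_by_fibres:
  assumes "finite A" "finite B" and "\<And>b. b \<in> B \<Longrightarrow> card {a \<in> A. R a b} = 1"
    and "\<And>a. a \<in> A \<Longrightarrow> even (card {b \<in> B. R a b})"
  shows "even (card B)"
proof -
  have "(\<Sum>a\<in>A. card {b \<in> B. R a b}) = (\<Sum>b\<in>B. 1)"
    using assms by (intro sum_multicount_gen) auto
  moreover have "even (\<Sum>a\<in>A. card {b \<in> B. R a b})"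
    using assms(4) by (intro dvd_sum) auto
  ultimately show ?thesis by simp
qed

text \<open>The incidences of a triangulated closed surface. Triangles and edges are abstract objects with a
  set of corners and a set of ends, because different edges may have the same ends and different
  triangles the same corners.\<close>
locale closed_triangle_complex =
  fixes V :: "'v set" and E :: "'e set" and T :: "'t set"
    and ends :: "'e \<Rightarrow> 'v set" and corners :: "'t \<Rightarrow> 'v set" and sides :: "'t \<Rightarrow> 'e set"
  assumes finite_V: "finite V" and finite_E: "finite E" and finite_T: "finite T"
    and ends: "e \<in> E \<Longrightarrow> ends e \<subseteq> V" "e \<in> E \<Longrightarrow> card (ends e) = 2"
    and corners: "t \<in> T \<Longrightarrow> corners t \<subseteq> V" "t \<in> T \<Longrightarrow> card (corners t) = 3"
    and sides: "t \<in> T \<Longrightarrow> sides t \<subseteq> E"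
      "t \<in> T \<Longrightarrow> bij_betw ends (sides t) {p. p \<subseteq> corners t \<and> card p = 2}"
    and two_triangles: "e \<in> E \<Longrightarrow> card {t \<in> T. e \<in> sides t} = 2"
begin

definition degree :: "'v \<Rightarrow> nat" where "degree v = card {e \<in> E. v \<in> ends e}"

lemma sides_subset: "t \<in> T \<Longrightarrow> e \<in> sides t \<Longrightarrow> ends e \<subseteq> corners t"
  using sides(2)[of t] unfolding bij_betw_def by blast

lemma side_between:
  assumes "t \<in> T" "u \<in> corners t" "v \<in> corners t" "u \<noteq> v"
  obtains e where "e \<in> sides t" "ends e = {u, v}"
    "\<forall>k\<in>sides t. ends k = {u, v} \<longrightarrow> k = e"
proof -
  have bij: "bij_betw ends (sides t) {p. p \<subseteq> corners t \<and> card p = 2}"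
    using sides(2)[OF assms(1)] .
  have "{u, v} \<in> ends ` sides t"
    unfolding bij_betw_imp_surj_on[OF bij] using assms by simp
  then obtain e where e: "e \<in> sides t" "{u, v} = ends e" by blast
  show thesis
  proof (rule that)
    show "e \<in> sides t" "ends e = {u, v}" using e by simp_all
    show "\<forall>k\<in>sides t. ends k = {u, v} \<longrightarrow> k = e"
      using inj_onD[OF bij_betw_imp_inj_on[OF bij]] e by simp
  qed
qed

lemma ends_at:
  assumes "e \<in> E" "v \<in> ends e" obtains u where "u \<noteq> v" "ends e = {v, u}" "u \<in> V"
proof -
  obtain p q where pq: "ends e = {p, q}" "p \<noteq> q" using ends(2)[OF assms(1)] unfolding card_2_iff by blast
  have V: "p \<in> V" "q \<in> V" using ends(1)[OF assms(1)] pq by auto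
  show thesis
  proof (cases "p = v")
    case True show ?thesis by (rule that[of q]) (use True pq V in auto)
  next
    case False show ?thesis by (rule that[of p]) (use False pq V assms(2) in auto)
  qed
qed

text \<open>A triangle at \<open>v\<close> has two sides at \<open>v\<close>, and an edge at \<open>v\<close> is a side of two triangles.\<close>
lemma triangles_at_vertex:
  assumes v: "v \<in> V"
  shows "card {t \<in> T. v \<in> corners t} = degree v"
proof -
  let ?A = "{e \<in> E. v \<in> ends e}" and ?B = "{t \<in> T. v \<in> corners t}"
  have "(\<Sum>e\<in>?A. card {t \<in> ?B. e \<in> sides t}) = (\<Sum>t\<in>?B. 2)"
  proof (rule sum_multicount_gen)
    show "finite ?A" "finite ?B" using finite_E finite_T by auto
    show "\<forall>t\<in>?B. card {e \<in> ?A. e \<in> sides t} = 2"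
    proof
      fix t assume t: "t \<in> ?B"
      then have "card (corners t - {v}) = 2"
        using corners(2)[of t] by (simp add: card_Diff_singleton)
      then obtain u w where uw: "corners t - {v} = {u, w}" "u \<noteq> w"
        unfolding card_2_iff by blast
      then have c: "corners t = {v, u, w}" "u \<noteq> v" "w \<noteq> v" using t by auto
      have tv: "t \<in> T" "v \<in> corners t" "u \<in> corners t" "w \<in> corners t" "v \<noteq> u" "v \<noteq> w"
        using t c by auto
      obtain e where e: "e \<in> sides t" "ends e = {v, u}" "\<forall>k\<in>sides t. ends k = {v, u} \<longrightarrow> k = e"
        by (rule side_between[OF tv(1,2,3,5)])
      obtain f where f: "f \<in> sides t" "ends f = {v, w}" "\<forall>k\<in>sides t. ends k = {v, w} \<longrightarrow> k = f"
        by (rule side_between[OF tv(1,2,4,6)])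
      have "{e \<in> ?A. e \<in> sides t} = {e, f}"
      proof
        show "{e, f} \<subseteq> {e \<in> ?A. e \<in> sides t}" using e(1,2) f(1,2) sides(1)[of t] t by auto
        show "{e \<in> ?A. e \<in> sides t} \<subseteq> {e, f}"
        proof
          fix k assume k: "k \<in> {e \<in> ?A. e \<in> sides t}"
          then obtain z where "z \<noteq> v" "ends k = {v, z}" using ends_at by blast
          moreover from this have "z = u \<or> z = w" using sides_subset[of t k] k t c by auto
          ultimately show "k \<in> {e, f}" using e(3) f(3) k by blast
        qed
      qed
      moreover have "e \<noteq> f" using e(2) f(2) uw by (auto simp: doubleton_eq_iff)
      ultimately show "card {e \<in> ?A. e \<in> sides t} = 2" by simp
    qed
  qed
  moreover have "card {t \<in> ?B. e \<in> sides t} = 2" if "e \<in> ?A" for e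
  proof -
    have "{t \<in> ?B. e \<in> sides t} = {t \<in> T. e \<in> sides t}"
      using that sides_subset by blast
    then show ?thesis using two_triangles that by simp
  qed
  ultimately show ?thesis unfolding degree_def by simp
qed

end

locale colored_triangle_complex = closed_triangle_complex V E T ends corners sides
  for V :: "'v set" and E :: "'e set" and T :: "'t set"
    and ends :: "'e \<Rightarrow> 'v set" and corners :: "'t \<Rightarrow> 'v set" and sides :: "'t \<Rightarrow> 'e set" +
  fixes c :: "'v \<Rightarrow> 'c"
  assumes proper: "e \<in> E \<Longrightarrow> inj_on c (ends e)"
begin

definition palette :: "'v \<Rightarrow> 'c set" where
  "palette v = insert (c v) (c ` \<Union>{ends e |e. e \<in> E \<and> v \<in> ends e})"

lemma inj_corners:
  assumes t: "t \<in> T" shows "inj_on c (corners t)"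
proof (rule inj_onI, rule ccontr)
  fix u v assume uv: "u \<in> corners t" "v \<in> corners t" "c u = c v" "u \<noteq> v"
  obtain e where "e \<in> sides t" "ends e = {u, v}" by (rule side_between[OF t uv(1,2,4)])
  then show False using proper[of e] sides(1)[OF t] uv by auto
qed

lemma card_colors: "t \<in> T \<Longrightarrow> card (c ` corners t) = 3"
  using inj_corners corners(2) card_image by metis

lemma colors_subset_palette:
  assumes t: "t \<in> T" and v: "v \<in> corners t" shows "c ` corners t \<subseteq> palette v"
proof
  fix a assume "a \<in> c ` corners t"
  then obtain u where u: "u \<in> corners t" "a = c u" by auto
  show "a \<in> palette v"
  proof (cases "u = v")
    case True then show ?thesis using u unfolding palette_def by simp
  next
    case False
    obtain e where e: "e \<in> sides t" "ends e = {u, v}" by (rule side_between[OF t u(1) v False])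
    then have "e \<in> E" using sides(1)[OF t] by blast
    then show ?thesis using e u unfolding palette_def by blast
  qed
qed

lemma finite_palette: "finite (palette v)"
proof -
  have "{ends e |e. e \<in> E \<and> v \<in> ends e} \<subseteq> ends ` E" by auto
  then have "finite {ends e |e. e \<in> E \<and> v \<in> ends e}" using finite_E finite_surj by blast
  moreover have "finite (ends e)" if "e \<in> E" for e using ends(1)[OF that] finite_V finite_subset by blast
  ultimately show ?thesis unfolding palette_def by auto
qed

text \<open>Such a triangle has a unique side from \<open>v\<close> to its corner of color \<open>b\<close>, and each edge of this
  kind is a side of two triangles.\<close>
lemma even_triangles_with_color:
  assumes v: "v \<in> V" and b: "b \<noteq> c v"
  shows "even (card {t \<in> T. v \<in> corners t \<and> b \<in> c ` corners t})"
proof -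
  let ?A = "{e \<in> E. v \<in> ends e \<and> b \<in> c ` ends e}"
  let ?B = "{t \<in> T. v \<in> corners t \<and> b \<in> c ` corners t}"
  show ?thesis
  proof (rule even_card_by_fibres[where A = ?A and R = "\<lambda>e t. e \<in> sides t"])
    show "finite ?A" "finite ?B" using finite_E finite_T by auto
  next
    fix t assume t: "t \<in> ?B"
    then obtain u where u: "u \<in> corners t" "c u = b" "u \<noteq> v" using b by auto
    have tt: "t \<in> T" "v \<in> corners t" using t by auto
    obtain e where e: "e \<in> sides t" "ends e = {u, v}" "\<forall>k\<in>sides t. ends k = {u, v} \<longrightarrow> k = e"
      by (rule side_between[OF tt(1) u(1) tt(2) u(3)])
    have "{e \<in> ?A. e \<in> sides t} = {e}"
    proof
      show "{e} \<subseteq> {e \<in> ?A. e \<in> sides t}" using e(1,2) u sides(1)[of t] t by auto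
      show "{e \<in> ?A. e \<in> sides t} \<subseteq> {e}"
      proof
        fix k assume k: "k \<in> {e \<in> ?A. e \<in> sides t}"
        then obtain w where w: "w \<in> ends k" "c w = b" by auto
        have "w = u"
          using inj_corners[of t] sides_subset[of t k] k w t u unfolding inj_on_def by blast
        moreover obtain z where "ends k = {v, z}" using k ends_at[of k v] by auto
        ultimately have "ends k = {u, v}" using w u by auto
        then show "k \<in> {e}" using e k by blast
      qed
    qed
    then show "card {e \<in> ?A. e \<in> sides t} = 1" by simp
  next
    fix e assume e: "e \<in> ?A"
    then have "{t \<in> ?B. e \<in> sides t} = {t \<in> T. e \<in> sides t}"
      using sides_subset by blast
    then show "even (card {t \<in> ?B. e \<in> sides t})" using two_triangles[of e] e by simp
  qed
qed

text \<open>A triangle at \<open>v\<close> without the color \<open>b\<close> must show the other three colors of the palette. The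
  triangles with \<open>b\<close> are even in number, and all triangles at \<open>v\<close> together are as many as
  the degree.\<close>
lemma parity_triangles_at_vertex:
  assumes v: "v \<in> V" and Q: "card (palette v) = 4" and b: "b \<in> palette v" "b \<noteq> c v"
  shows "even (card {t \<in> T. v \<in> corners t \<and> c ` corners t = palette v - {b}}) \<longleftrightarrow> even (degree v)"
proof -
  let ?F = "{t \<in> T. v \<in> corners t}"
  let ?B = "{t \<in> T. v \<in> corners t \<and> b \<in> c ` corners t}"
  let ?C = "{t \<in> T. v \<in> corners t \<and> c ` corners t = palette v - {b}}"
  have "c ` corners t = palette v - {b}" if "t \<in> ?F" "b \<notin> c ` corners t" for t
  proof (rule card_subset_eq)
    show "finite (palette v - {b})" using finite_palette by simp
    show "c ` corners t \<subseteq> palette v - {b}" using colors_subset_palette that by blast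
    show "card (c ` corners t) = card (palette v - {b})"
      using card_colors that Q b finite_palette by simp
  qed
  then have "?F = ?B \<union> ?C" by auto
  moreover have "?B \<inter> ?C = {}" by auto
  ultimately have "card ?F = card ?B + card ?C"
    using finite_T by (simp add: card_Un_disjoint)
  then show ?thesis
    using triangles_at_vertex[OF v] even_triangles_with_color[OF v b(2)] by simp
qed

text \<open>With only three colors in the palette, every triangle at \<open>v\<close> shows all of them, so the
  triangles with some fixed color other than that of \<open>v\<close> are all the triangles at \<open>v\<close>, an even
  number.\<close>
lemma odd_vertex_palette:
  assumes v: "v \<in> V" and odd: "odd (degree v)"
  shows "card (palette v) \<ge> 4"
proof (rule ccontr)
  assume less: "\<not> card (palette v) \<ge> 4"
  let ?F = "{t \<in> T. v \<in> corners t}"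
  have eq: "c ` corners t = palette v" if "t \<in> ?F" for t
    using colors_subset_palette[of t v] card_colors[of t] that less finite_palette
    by (intro card_seteq) auto
  have "?F \<noteq> {}" using odd triangles_at_vertex[OF v] by (metis card.empty even_zero)
  then obtain t where t: "t \<in> ?F" by blast
  then have "card (palette v) = 3" using eq card_colors by fastforce
  then have "\<not> palette v \<subseteq> {c v}" using card_mono[of "{c v}" "palette v"] by auto
  then obtain b where b: "b \<in> palette v" "b \<noteq> c v" by blast
  then have "{t \<in> T. v \<in> corners t \<and> b \<in> c ` corners t} = ?F" using eq by auto
  then show False using even_triangles_with_color[OF v b(2)] odd triangles_at_vertex[OF v] by simp
qed

definition odd_vertices :: "'c \<Rightarrow> 'c set \<Rightarrow> 'v set" where
  "odd_vertices a Q = {v \<in> V. c v = a \<and> palette v = Q \<and> odd (degree v)}"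

text \<open>These mediate between odd vertices of different colors: for fixed \<open>P\<close> and \<open>Q\<close>, changing \<open>a\<close> only
  changes the corner that is inspected.\<close>
definition pointed_triangles :: "'c set \<Rightarrow> 'c \<Rightarrow> 'c set \<Rightarrow> 't set" where
  "pointed_triangles P a Q = {t \<in> T. c ` corners t = P \<and> (\<exists>v\<in>corners t. c v = a \<and> palette v = Q)}"

text \<open>Sum the local parities over the vertices of color \<open>a\<close> and palette \<open>Q\<close>; a triangle has only one
  corner of color \<open>a\<close> and is counted once.\<close>
lemma parity_pointed_triangles:
  assumes Q: "card Q = 4" and b: "b \<in> Q" and a: "a \<in> Q" "a \<noteq> b"
  shows "even (card (pointed_triangles (Q - {b}) a Q)) \<longleftrightarrow> even (card (odd_vertices a Q))"
proof -
  let ?A = "{v \<in> V. c v = a \<and> palette v = Q}"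
  let ?B = "pointed_triangles (Q - {b}) a Q"
  have "(\<Sum>v\<in>?A. card {t \<in> ?B. v \<in> corners t}) = (\<Sum>t\<in>?B. 1)"
  proof (rule sum_multicount_gen)
    show "finite ?A" "finite ?B" using finite_V finite_T unfolding pointed_triangles_def by auto
    show "\<forall>t\<in>?B. card {v \<in> ?A. v \<in> corners t} = 1"
    proof
      fix t assume "t \<in> ?B"
      then obtain v where t: "t \<in> T" and v: "v \<in> corners t" "c v = a" "palette v = Q"
        unfolding pointed_triangles_def by blast
      then have "{v \<in> ?A. v \<in> corners t} = {v}"
        using inj_corners[OF t] corners(1)[OF t] unfolding inj_on_def by auto
      then show "card {v \<in> ?A. v \<in> corners t} = 1" by simp
    qed
  qed
  then have s: "card ?B = (\<Sum>v\<in>?A. card {t \<in> ?B. v \<in> corners t})" by simp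
  have *: "even (card {t \<in> ?B. v \<in> corners t}) \<longleftrightarrow> even (degree v)" if v: "v \<in> ?A" for v
  proof -
    have "{t \<in> ?B. v \<in> corners t} = {t \<in> T. v \<in> corners t \<and> c ` corners t = palette v - {b}}"
      using v unfolding pointed_triangles_def by auto
    then show ?thesis using parity_triangles_at_vertex[of v b] v Q a b by auto
  qed
  have "even (card ?B) \<longleftrightarrow> even (card {v \<in> ?A. odd (card {t \<in> ?B. v \<in> corners t})})"
    unfolding s using finite_V by (subst even_sum_iff) auto
  also have "{v \<in> ?A. odd (card {t \<in> ?B. v \<in> corners t})} = odd_vertices a Q"
    using * unfolding odd_vertices_def by auto
  finally show ?thesis .
qed

end

locale locally_four_colored_complex = colored_triangle_complex +
  assumes card_palette: "v \<in> V \<Longrightarrow> card (palette v) \<le> 4"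
begin

text \<open>The two triangles at \<open>e\<close> together show four colors, and this exhausts the palette of either end
  of \<open>e\<close>.\<close>
lemma palettes_agree:
  assumes st: "s \<in> T" "t \<in> T" "e \<in> sides s" "e \<in> sides t" and ne: "c ` corners s \<noteq> c ` corners t"
    and v: "v \<in> ends e"
  shows "palette v = c ` corners s \<union> c ` corners t"
proof (rule sym, rule card_seteq)
  have vv: "v \<in> corners s" "v \<in> corners t" using sides_subset st v by auto
  show "finite (palette v)" by (rule finite_palette)
  show "c ` corners s \<union> c ` corners t \<subseteq> palette v"
    using colors_subset_palette st vv by blast
  have f: "finite (c ` corners s \<union> c ` corners t)"
    using corners(1) st finite_V finite_subset by (metis finite_UnI finite_imageI)
  have "c ` corners s \<subset> c ` corners s \<union> c ` corners t"
  proof -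
    have "c ` corners t \<subseteq> c ` corners s \<Longrightarrow> c ` corners t = c ` corners s"
      using f card_colors st by (intro card_subset_eq) auto
    then show ?thesis using ne by blast
  qed
  then have "card (c ` corners s \<union> c ` corners t) > 3"
    using psubset_card_mono[OF f] card_colors st by metis
  moreover have "v \<in> V" using vv corners(1) st by blast
  ultimately show "card (palette v) \<le> card (c ` corners s \<union> c ` corners t)"
    using card_palette[of v] by linarith
qed

text \<open>The triangles are those whose corners of colors \<open>a\<close> and \<open>a'\<close> are told apart by having palette
  \<open>Q\<close> or not. They are counted by their side between these two corners: at such an edge
  both triangles have the same color set, by the previous lemma, so it contributes none or two.\<close>
lemma even_mixed_triangles:
  assumes a: "a \<noteq> a'" "a \<in> P" "a' \<in> P"
  shows "even (card {t \<in> T. c ` corners t = P \<and>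
     (t \<in> pointed_triangles P a Q) \<noteq> (t \<in> pointed_triangles P a' Q)})"
proof -
  define mixed where "mixed e \<longleftrightarrow> (\<exists>u v. ends e = {u, v} \<and> c u = a \<and> c v = a' \<and>
      (palette u = Q) \<noteq> (palette v = Q))" for e
  let ?A = "{e \<in> E. mixed e}"
  let ?B = "{t \<in> T. c ` corners t = P \<and>
     (t \<in> pointed_triangles P a Q) \<noteq> (t \<in> pointed_triangles P a' Q)}"
  \<comment> \<open>The colors of the corners of a triangle are distinct, so membership is decided at any one
    corner of color \<open>b\<close>.\<close>
  have cornerpt: "t \<in> pointed_triangles P b Q \<longleftrightarrow> palette u = Q"
    if "t \<in> T" "c ` corners t = P" "u \<in> corners t" "c u = b" for t u b
    using that inj_corners[of t] unfolding pointed_triangles_def inj_on_def by auto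
  show ?thesis
  proof (rule even_card_by_fibres[where A = ?A and R = "\<lambda>e t. e \<in> sides t"])
    show "finite ?A" "finite ?B" using finite_E finite_T by auto
  next
    fix t assume t: "t \<in> ?B"
    then obtain u v where u: "u \<in> corners t" "c u = a" and v: "v \<in> corners t" "c v = a'"
      using a by blast
    then have uv: "u \<noteq> v" using a by auto
    have tt: "t \<in> T" using t by auto
    obtain e where e: "e \<in> sides t" "ends e = {u, v}" "\<forall>k\<in>sides t. ends k = {u, v} \<longrightarrow> k = e"
      by (rule side_between[OF tt u(1) v(1) uv])
    have "(palette u = Q) \<noteq> (palette v = Q)"
      using cornerpt[OF tt _ u] cornerpt[OF tt _ v] t by blast
    then have "mixed e" unfolding mixed_def using e(2) u(2) v(2) by blast
    have "{e \<in> ?A. e \<in> sides t} = {e}"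
    proof
      show "{e} \<subseteq> {e \<in> ?A. e \<in> sides t}" using e(1,2) \<open>mixed e\<close> sides(1)[of t] t by auto
      show "{e \<in> ?A. e \<in> sides t} \<subseteq> {e}"
      proof
        fix k assume k: "k \<in> {e \<in> ?A. e \<in> sides t}"
        then obtain w z where w: "ends k = {w, z}" "c w = a" "c z = a'" unfolding mixed_def by auto
        then have "w \<in> corners t" "z \<in> corners t" using sides_subset[of t k] k t by auto
        then have "w = u" "z = v" using inj_corners[of t] t w u v unfolding inj_on_def by auto
        then show "k \<in> {e}" using e k w by blast
      qed
    qed
    then show "card {e \<in> ?A. e \<in> sides t} = 1" by simp
  next
    fix e assume e: "e \<in> ?A"
    then obtain u v where uv: "ends e = {u, v}" "c u = a" "c v = a'" "(palette u = Q) \<noteq> (palette v = Q)"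
      unfolding mixed_def by blast
    have same: "c ` corners s = c ` corners t" if "s \<in> T" "t \<in> T" "e \<in> sides s" "e \<in> sides t" for s t
    proof (rule ccontr)
      assume ne: "c ` corners s \<noteq> c ` corners t"
      have "palette u = palette v"
        using palettes_agree[OF that ne, of u] palettes_agree[OF that ne, of v] uv(1) by simp
      then show False using uv(4) by simp
    qed
    have B: "t \<in> ?B \<longleftrightarrow> c ` corners t = P" if "t \<in> T" "e \<in> sides t" for t
      using cornerpt[OF that(1) _ _ uv(2)] cornerpt[OF that(1) _ _ uv(3)] uv(1,4)
        sides_subset[OF that] that(1) by blast
    have "{t \<in> ?B. e \<in> sides t} = {} \<or> {t \<in> ?B. e \<in> sides t} = {t \<in> T. e \<in> sides t}"
      using same B by blast
    then show "even (card {t \<in> ?B. e \<in> sides t})"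
      using two_triangles[of e] e by (metis (no_types, lifting) card.empty even_numeral even_zero mem_Collect_eq)
  qed
qed

lemma parity_pointed_triangles_eq:
  assumes a: "a \<noteq> a'" "a \<in> P" "a' \<in> P"
  shows "even (card (pointed_triangles P a Q)) \<longleftrightarrow> even (card (pointed_triangles P a' Q))"
proof -
  let ?X = "pointed_triangles P a Q" and ?Y = "pointed_triangles P a' Q"
  have "{t \<in> T. c ` corners t = P \<and> (t \<in> ?X) \<noteq> (t \<in> ?Y)} = (?X - ?Y) \<union> (?Y - ?X)"
    unfolding pointed_triangles_def by auto
  moreover have f: "finite ?X" "finite ?Y" using finite_T unfolding pointed_triangles_def by auto
  moreover have "card ((?X - ?Y) \<union> (?Y - ?X)) = card (?X - ?Y) + card (?Y - ?X)"
    using f by (intro card_Un_disjoint) auto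
  ultimately have "even (card (?X - ?Y) + card (?Y - ?X))"
    using even_mixed_triangles[OF a, of Q] by simp
  moreover have "card ?X = card (?X - ?Y) + card (?X \<inter> ?Y)"
    using f by (metis add.commute card_Int_Diff)
  moreover have "card ?Y = card (?Y - ?X) + card (?X \<inter> ?Y)"
    using f by (metis add.commute card_Int_Diff inf_commute)
  ultimately show ?thesis by presburger
qed

text \<open>Compare \<open>a\<close> and \<open>a'\<close> on the triangles whose color set is \<open>Q\<close> without some third color \<open>b\<close>.\<close>
lemma parity_odd_vertices_eq:
  assumes Q: "card Q = 4" and a: "a \<in> Q" "a' \<in> Q"
  shows "even (card (odd_vertices a Q)) \<longleftrightarrow> even (card (odd_vertices a' Q))"
proof (cases "a = a'")
  case False
  have "card (Q - {a, a'}) = 2" using Q a False by (simp add: card_Diff_subset)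
  then obtain b where b: "b \<in> Q" "b \<noteq> a" "b \<noteq> a'" by (metis Diff_iff card.empty ex_in_conv insertCI zero_neq_numeral)
  then show ?thesis
    using parity_pointed_triangles[OF Q b(1)] parity_pointed_triangles_eq[of a a' "Q - {b}" Q] a False
    by auto
qed simp

text \<open>If the types (color and palette) of \<open>x\<close> and \<open>y\<close> differed, \<open>x\<close> would be the only odd vertex of
  its type, so all four colors of its palette would occur among the colors of \<open>x\<close> and \<open>y\<close>.\<close>
theorem two_odd_vertices:
  assumes xy: "x \<in> V" "y \<in> V" "odd (degree x)" "odd (degree y)" "x \<noteq> y"
    and even: "\<And>v. v \<in> V \<Longrightarrow> v \<noteq> x \<Longrightarrow> v \<noteq> y \<Longrightarrow> even (degree v)"
  shows "c x = c y \<and> palette x = palette y \<and> card (palette x) = 4"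
proof -
  define Q where "Q = palette x"
  have Q: "card Q = 4"
    using odd_vertex_palette card_palette xy unfolding Q_def by (simp add: eq_iff)
  have "c y = c x \<and> palette y = Q"
  proof (rule ccontr)
    assume ne: "\<not> (c y = c x \<and> palette y = Q)"
    have "v = x \<or> v = y" if "v \<in> odd_vertices a R" for v a R
      using even that unfolding odd_vertices_def by blast
    then have "odd_vertices (c x) Q = {x}"
      using ne xy unfolding odd_vertices_def Q_def by auto
    then have *: "odd (card (odd_vertices a Q))" if "a \<in> Q" for a
      using parity_odd_vertices_eq[OF Q that, of "c x"] unfolding Q_def palette_def by simp
    have "Q \<subseteq> {c x, c y}"
    proof
      fix a assume "a \<in> Q"
      then obtain v where "v \<in> odd_vertices a Q" using * by (metis card.empty even_zero ex_in_conv)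
      then show "a \<in> {c x, c y}" using even unfolding odd_vertices_def by blast
    qed
    then have "card Q \<le> card {c x, c y}" by (intro card_mono) auto
    also have "\<dots> \<le> 2" by (simp add: card_insert_if)
    finally show False using Q by simp
  qed
  then show ?thesis using Q unfolding Q_def by simp
qed

end

section \<open>Invariance of domain in surfaces\<close>

text \<open>Being open is a local matter, and in a chart this is invariance of domain in the plane.\<close>
lemma invariance_of_domain_surface:
  fixes A :: "(real^2) set"
  assumes S: "surface S" and A: "open A" and cont: "continuous_map (top_of_set A) S \<phi>"
    and inj: "inj_on \<phi> A"
  shows "openin S (\<phi> ` A)"
proof (subst openin_subopen, intro ballI)
  fix p assume "p \<in> \<phi> ` A"
  then obtain a where a: "a \<in> A" "p = \<phi> a" by auto
  have pS: "p \<in> topspace S"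
    using cont a by (auto simp: continuous_map_def)
  then obtain U where U: "openin S U" "p \<in> U"
      "subtopology S U homeomorphic_space (euclidean :: (real^2) topology)"
    using S unfolding surface_def by blast
  then obtain \<psi> where \<psi>: "homeomorphic_map (subtopology S U) (euclidean :: (real^2) topology) \<psi>"
    unfolding homeomorphic_space by blast
  have topU: "topspace (subtopology S U) = U"
    using U(1) openin_subset by fastforce
  define B where "B = {b \<in> A. \<phi> b \<in> U}"
  have "openin (top_of_set A) B"
    using openin_continuous_map_preimage[OF cont U(1)] unfolding B_def by simp
  then have B: "open B"
    using A openin_open_eq by blast
  have "continuous_map (top_of_set B) (subtopology S U) \<phi>"
  proof -
    have "continuous_map (top_of_set B) S \<phi>"
      using cont continuous_map_from_subtopology_mono[of euclidean A S \<phi> B] unfolding B_def by blast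
    moreover have "\<phi> ` B \<subseteq> U" unfolding B_def by blast
    ultimately show ?thesis
      by (simp add: continuous_map_in_subtopology image_subset_iff_funcset)
  qed
  then have "continuous_map (top_of_set B) euclidean (\<psi> \<circ> \<phi>)"
    using \<psi> continuous_map_compose homeomorphic_imp_continuous_map by blast
  then have c: "continuous_on B (\<psi> \<circ> \<phi>)" by simp
  have inj\<psi>: "inj_on \<psi> U"
    using \<psi> topU homeomorphic_imp_injective_map by metis
  have "inj_on (\<psi> \<circ> \<phi>) B"
    using inj inj\<psi> unfolding B_def inj_on_def by auto
  then have op: "open ((\<psi> \<circ> \<phi>) ` B)"
    using invariance_of_domain c B by blast
  define W where "W = {z \<in> U. \<psi> z \<in> (\<psi> \<circ> \<phi>) ` B}"
  have "openin (subtopology S U) W"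
    using openin_continuous_map_preimage[OF homeomorphic_imp_continuous_map[OF \<psi>], of "(\<psi> \<circ> \<phi>) ` B"]
      op unfolding W_def topU by simp
  then have "openin S W"
    using U(1) openin_trans_full by blast
  moreover have "p \<in> W"
    using a U(2) unfolding W_def B_def by auto
  moreover have "W \<subseteq> \<phi> ` A"
  proof
    fix z assume "z \<in> W"
    then obtain b where "z \<in> U" "b \<in> A" "\<phi> b \<in> U" "\<psi> z = \<psi> (\<phi> b)"
      unfolding W_def B_def by auto
    then show "z \<in> \<phi> ` A" using inj_onD[OF inj\<psi>, of z "\<phi> b"] by blast
  qed
  ultimately show "\<exists>T. openin S T \<and> p \<in> T \<and> T \<subseteq> \<phi> ` A" by blast
qed

text \<open>A converse: a set of the plane that covers a neighborhood of a point of the surface is itself a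
  neighborhood of the corresponding point. The inverse of the embedding maps a small open piece of
  the surface, read as an open set of the plane, injectively into \<open>A\<close>.\<close>
lemma embedding_neighborhood_interior:
  fixes A :: "(real^2) set"
  assumes S: "surface S" and emb: "embedding_map (top_of_set A) S \<phi>" and a: "a \<in> A"
    and W: "openin S W" "\<phi> a \<in> W" "W \<subseteq> \<phi> ` A"
  shows "a \<in> interior A"
proof -
  have "\<phi> a \<in> topspace S" using W openin_subset by blast
  then obtain U where U: "openin S U" "\<phi> a \<in> U"
      "subtopology S U homeomorphic_space (euclidean :: (real^2) topology)"
    using S unfolding surface_def by blast
  then obtain \<psi> \<psi>' where \<psi>: "homeomorphic_maps (subtopology S U) (euclidean :: (real^2) topology) \<psi> \<psi>'"
    unfolding homeomorphic_space_def by blast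
  have topU: "topspace (subtopology S U) = U"
    using U(1) openin_subset by fastforce
  obtain \<kappa> where \<kappa>: "homeomorphic_maps (top_of_set A) (subtopology S (\<phi> ` A)) \<phi> \<kappa>"
    using emb unfolding embedding_map_def homeomorphic_map_maps by auto
  have left: "\<kappa> (\<phi> b) = b" if "b \<in> A" for b
    using \<kappa> that unfolding homeomorphic_maps_def by auto
  have c': "continuous_map euclidean (subtopology S U) \<psi>'"
    using \<psi> unfolding homeomorphic_maps_def by blast
  have right: "\<psi>' z \<in> U" "\<psi> (\<psi>' z) = z" for z
    using \<psi> unfolding homeomorphic_maps_def by (auto simp: continuous_map_def topU)
  define B where "B = {z. \<psi>' z \<in> W}"
  have "openin (subtopology S U) (U \<inter> W)"
    using W U by (simp add: openin_subtopology_Int2)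
  from openin_continuous_map_preimage[OF c' this] have B: "open B"
    using right unfolding B_def by simp
  have "continuous_map (top_of_set B) (subtopology S (\<phi> ` A)) \<psi>'"
  proof -
    have "continuous_map (top_of_set B) S \<psi>'"
      using c' continuous_map_from_subtopology continuous_map_into_fulltopology by blast
    moreover have "\<psi>' ` B \<subseteq> \<phi> ` A" using W(3) unfolding B_def by blast
    ultimately show ?thesis
      by (simp add: continuous_map_in_subtopology image_subset_iff_funcset)
  qed
  moreover have "continuous_map (subtopology S (\<phi> ` A)) (top_of_set A) \<kappa>"
    using \<kappa> unfolding homeomorphic_maps_def by blast
  ultimately have "continuous_map (top_of_set B) (top_of_set A) (\<kappa> \<circ> \<psi>')"
    by (rule continuous_map_compose)
  then have c: "continuous_on B (\<kappa> \<circ> \<psi>')" and im: "(\<kappa> \<circ> \<psi>') ` B \<subseteq> A"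
    by (auto simp: continuous_map_in_subtopology)
  have "inj_on (\<kappa> \<circ> \<psi>') B"
  proof (rule inj_onI)
    fix z w assume zw: "z \<in> B" "w \<in> B" "(\<kappa> \<circ> \<psi>') z = (\<kappa> \<circ> \<psi>') w"
    obtain b d where "b \<in> A" "\<psi>' z = \<phi> b" "d \<in> A" "\<psi>' w = \<phi> d"
      using zw W(3) unfolding B_def by blast
    then have "\<psi>' z = \<psi>' w" using zw left by simp
    then show "z = w" using right by metis
  qed
  then have "open ((\<kappa> \<circ> \<psi>') ` B)"
    using invariance_of_domain c B by blast
  moreover have "a \<in> (\<kappa> \<circ> \<psi>') ` B"
  proof
    have e: "\<psi>' (\<psi> (\<phi> a)) = \<phi> a"
      using \<psi> U topU unfolding homeomorphic_maps_def by auto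
    show "a = (\<kappa> \<circ> \<psi>') (\<psi> (\<phi> a))" using e left a by simp
    show "\<psi> (\<phi> a) \<in> B" using e W unfolding B_def by simp
  qed
  ultimately show ?thesis using im interiorI by blast
qed

section \<open>Edges and faces of a triangulated surface\<close>

lemma joins_sym:
  assumes "joins S e u v" shows "joins S e v u"
proof -
  obtain g where g: "embedding_map (top_of_set {0..1::real}) S g" "g ` {0..1} = e" "g 0 = u" "g 1 = v"
    using assms unfolding joins_def by blast
  let ?r = "\<lambda>t::real. 1 - t"
  have im: "?r ` {0..1} = {0..1}"
    by (auto simp: image_iff intro!: bexI[where x = "1 - _"])
  have "homeomorphic_maps (top_of_set {0..1::real}) (top_of_set {0..1}) ?r ?r"
    unfolding homeomorphic_maps_def
    by (auto simp: continuous_map_in_subtopology intro!: continuous_intros)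
  then have "homeomorphic_map (top_of_set {0..1::real}) (top_of_set {0..1}) ?r"
    using homeomorphic_map_maps by blast
  then have "embedding_map (top_of_set {0..1::real}) (top_of_set {0..1}) ?r"
    using surjective_embedding_map by blast
  then have "embedding_map (top_of_set {0..1::real}) S (g \<circ> ?r)"
    using g(1) embedding_map_compose by blast
  moreover have "(g \<circ> ?r) ` {0..1} = e" using im g(2) by (metis image_comp)
  ultimately show ?thesis unfolding joins_def using g by fastforce
qed

lemma embedding_map_continuous: "embedding_map X Y g \<Longrightarrow> continuous_map X Y g"
  unfolding embedding_map_def
  using continuous_map_into_fulltopology homeomorphic_imp_continuous_map by blast

lemma embedding_map_inj_on: "embedding_map (top_of_set A) S g \<Longrightarrow> inj_on g A"
  by (metis embedding_map_def homeomorphic_imp_injective_map topspace_euclidean_subtopology)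

lemma joinsD:
  assumes "joins S e u v"
  shows "u \<in> e" "v \<in> e" "u \<noteq> v" "infinite e" "compactin S e"
proof -
  obtain g where g: "embedding_map (top_of_set {0..1::real}) S g" "g ` {0..1} = e" "g 0 = u" "g 1 = v"
    using assms unfolding joins_def by blast
  have i: "inj_on g {0..1}" using embedding_map_inj_on[OF g(1)] .
  show "u \<in> e" "v \<in> e" using g by auto
  have "g 0 \<noteq> g 1" using inj_onD[OF i, of 0 1] by auto
  then show "u \<noteq> v" using g by simp
  show "infinite e"
    using g(2) i finite_imageD infinite_Icc[of "0::real" 1] by fastforce
  show "compactin S e"
    using image_compactin[of "top_of_set {0..1::real}" "{0..1}" S g]
      embedding_map_continuous[OF g(1)] g(2) by (simp add: compactin_subtopology)
qed

locale surface_triangulated =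
  fixes S :: "'a topology" and V :: "'a set" and E :: "'a set set"
  assumes triangulation: "surface_triangulation S V E"
begin

text \<open>The sides and corners of a face are read off from its closure, so that they do not depend on
  the choice of a parametrization of the face.\<close>
definition sides :: "'a set \<Rightarrow> 'a set set" where
  "sides F = {e \<in> E. e \<subseteq> S closure_of F}"

definition corners :: "'a set \<Rightarrow> 'a set" where
  "corners F = V \<inter> S closure_of F"

abbreviation disc :: "(real^2) set" where "disc \<equiv> cball 0 1"
abbreviation circle :: "(real^2) set" where "circle \<equiv> sphere 0 1"

lemma surf: "surface S" and graph: "embedded_graph S V E"
  and triangular: "F \<in> faces S V E \<Longrightarrow> triangular_face S V E F"
  using triangulation unfolding surface_triangulation_def by auto

lemma Hausdorff: "Hausdorff_space S"
  using surf unfolding surface_def by blast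

lemma finite_V: "finite V" and finite_E: "finite E" and V_subset: "V \<subseteq> topspace S"
  using graph unfolding embedded_graph_def by auto

lemma edge_joins:
  assumes "e \<in> E" obtains u v where "u \<in> V" "v \<in> V" "joins S e u v" "e \<inter> V = {u, v}"
proof -
  have "\<exists>u\<in>V. \<exists>v\<in>V. joins S e u v \<and> e \<inter> V = {u, v}"
    using graph assms unfolding embedded_graph_def by simp
  then show thesis using that by (elim bexE conjE)
qed

lemma edges_meet: "e \<in> E \<Longrightarrow> f \<in> E \<Longrightarrow> e \<noteq> f \<Longrightarrow> e \<inter> f \<subseteq> V"
  using graph unfolding embedded_graph_def by blast

lemma edge_ends:
  assumes e: "e \<in> E" and j: "joins S e u v" and uv: "u \<in> V" "v \<in> V"
  shows "e \<inter> V = {u, v}"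
proof -
  obtain a b where ab: "e \<inter> V = {a, b}" using edge_joins[OF e] by metis
  have "u \<in> e \<inter> V" "v \<in> e \<inter> V" "u \<noteq> v" using joinsD[OF j] uv by auto
  then show ?thesis unfolding ab by auto
qed

lemma edge_closed: assumes "e \<in> E" shows "closedin S e"
proof -
  obtain u v where "u \<in> V" "v \<in> V" and j: "joins S e u v" and "e \<inter> V = {u, v}"
    by (rule edge_joins[OF assms])
  show ?thesis by (rule compactin_imp_closedin[OF Hausdorff joinsD(5)[OF j]])
qed

lemma edge_interior: assumes "e \<in> E" obtains p where "p \<in> e" "p \<notin> V"
proof -
  obtain u v where "u \<in> V" "v \<in> V" and j: "joins S e u v" and "e \<inter> V = {u, v}"
    by (rule edge_joins[OF assms])
  have "infinite e" by (rule joinsD(4)[OF j])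
  then have "\<not> e \<subseteq> V" using finite_V finite_subset by blast
  then show thesis using that by blast
qed

text \<open>An open set that contains the interior of \<open>e\<close> and meets no other part of the graph.\<close>
definition star :: "'a set \<Rightarrow> 'a set" where
  "star e = topspace S - (V \<union> \<Union>(E - {e}))"

lemma open_star: "openin S (star e)"
proof -
  have "closedin S V"
    using closedin_Hausdorff_finite[OF Hausdorff] finite_V V_subset by blast
  moreover have "closedin S (\<Union>(E - {e}))"
    using finite_E edge_closed by (intro closedin_Union) auto
  ultimately show ?thesis unfolding star_def
    by (simp add: closedin_Un openin_diff)
qed

lemma edge_minus_vertices_star: "e \<in> E \<Longrightarrow> e - V \<subseteq> star e"
  using edges_meet[of e] closedin_subset[OF edge_closed, of e] unfolding star_def by blast

lemma Union_faces: "\<Union>(faces S V E) = topspace S - (V \<union> \<Union>E)"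
  unfolding faces_def Union_connected_components_of topspace_subtopology by blast

lemma face_avoids: "F \<in> faces S V E \<Longrightarrow> F \<inter> V = {}" "F \<in> faces S V E \<Longrightarrow> e \<in> E \<Longrightarrow> F \<inter> e = {}"
  using Union_faces by blast+

lemma faces_disjoint: "F \<in> faces S V E \<Longrightarrow> G \<in> faces S V E \<Longrightarrow> F \<noteq> G \<Longrightarrow> F \<inter> G = {}"
  unfolding faces_def disjnt_def[symmetric]
  by (rule pairwiseD[OF pairwise_disjoint_connected_components_of])

lemma star_subset: "star e \<subseteq> e \<union> \<Union>(faces S V E)"
  unfolding Union_faces star_def by blast

text \<open>The closed disc of a triangular face is compact, so it is the closure of the face. An edge in this
  closure has a point that is not a vertex, and since edges cross only in vertices, it must be one of
  the three bounding edges.\<close>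
lemma face_boundary:
  assumes F: "F \<in> faces S V E"
  obtains h u v w e f g where
    "embedding_map (top_of_set disc) S h" "h ` ball 0 1 = F" "h ` circle = e \<union> f \<union> g"
    "sides F = {e, f, g}" "corners F = {u, v, w}"
    "e \<inter> V = {u, v}" "f \<inter> V = {v, w}" "g \<inter> V = {w, u}"
    "u \<noteq> v" "v \<noteq> w" "w \<noteq> u" "S closure_of F = F \<union> e \<union> f \<union> g"
proof -
  obtain u v w e f g h where uvw: "u \<in> V" "v \<in> V" "w \<in> V" and efg: "e \<in> E" "f \<in> E" "g \<in> E"
    and j: "joins S e u v" "joins S f v w" "joins S g w u"
    and h: "embedding_map (top_of_set disc) S h" "h ` ball 0 1 = F" "h ` circle = e \<union> f \<union> g"
    using triangular[OF F] unfolding triangular_face_def by (elim bexE exE conjE) (rule that)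
  have ends: "e \<inter> V = {u, v}" "f \<inter> V = {v, w}" "g \<inter> V = {w, u}"
    using edge_ends[OF efg(1) j(1) uvw(1,2)] edge_ends[OF efg(2) j(2) uvw(2,3)]
      edge_ends[OF efg(3) j(3) uvw(3,1)] .
  have ne: "u \<noteq> v" "v \<noteq> w" "w \<noteq> u"
    using joinsD(3)[OF j(1)] joinsD(3)[OF j(2)] joinsD(3)[OF j(3)] .
  have hd: "h ` disc = F \<union> e \<union> f \<union> g"
  proof -
    have "disc = ball 0 1 \<union> circle" by auto
    then show ?thesis using h(2,3) by (simp add: image_Un Un_assoc)
  qed
  have cont: "continuous_map (top_of_set disc) S h" using embedding_map_continuous h(1) .
  have cl: "S closure_of F = F \<union> e \<union> f \<union> g"
  proof
    have "compactin S (h ` disc)"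
      by (rule image_compactin[OF _ cont]) (simp add: compactin_subtopology)
    then have "closedin S (F \<union> e \<union> f \<union> g)"
      using compactin_imp_closedin[OF Hausdorff] hd by simp
    then show "S closure_of F \<subseteq> F \<union> e \<union> f \<union> g"
      by (intro closure_of_minimal) auto
    have "top_of_set disc closure_of (ball 0 1) = disc"
      by (auto simp: closure_of_subtopology inf.absorb2)
    then show "F \<union> e \<union> f \<union> g \<subseteq> S closure_of F"
      using continuous_map_image_closure_subset[OF cont, of "ball 0 1"] hd h(2) by simp
  qed
  have "sides F = {e, f, g}"
  proof
    show "{e, f, g} \<subseteq> sides F" unfolding sides_def cl using efg by auto
    show "sides F \<subseteq> {e, f, g}"
    proof
      fix k assume "k \<in> sides F"
      then have k: "k \<in> E" "k \<subseteq> F \<union> e \<union> f \<union> g" unfolding sides_def cl by auto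
      obtain p where p: "p \<in> k" "p \<notin> V" using edge_interior[OF k(1)] .
      then show "k \<in> {e, f, g}"
        using k face_avoids(2)[OF F k(1)] edges_meet[OF k(1)] efg by blast
    qed
  qed
  moreover have "corners F = {u, v, w}"
  proof -
    have "corners F = (F \<inter> V) \<union> (e \<inter> V) \<union> (f \<inter> V) \<union> (g \<inter> V)"
      unfolding corners_def cl by blast
    then show ?thesis unfolding face_avoids(1)[OF F] ends by blast
  qed
  ultimately show thesis by (rule that[OF h _ _ ends ne cl])
qed

lemma side_of_face:
  assumes F: "F \<in> faces S V E" and e: "e \<in> E" and p: "p \<in> e" "p \<notin> V" "p \<in> S closure_of F"
  shows "e \<in> sides F"
proof (rule face_boundary[OF F])
  fix h u v w a b c
  assume "sides F = {a, b, c}" "S closure_of F = F \<union> a \<union> b \<union> c"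
  moreover from this have "a \<in> E" "b \<in> E" "c \<in> E" unfolding sides_def by blast+
  ultimately show ?thesis
    using p edges_meet[OF e] face_avoids(2)[OF F e] by blast
qed

text \<open>A component of an open set need not be open in general; here the parametrization of the face by an
  open disc settles it.\<close>
lemma face_open:
  assumes F: "F \<in> faces S V E" shows "openin S F"
proof (rule face_boundary[OF F])
  fix h assume h: "embedding_map (top_of_set disc) S h" "h ` ball 0 1 = F"
  have "continuous_map (top_of_set (ball 0 1)) S h"
    using continuous_map_from_subtopology_mono[OF embedding_map_continuous[OF h(1)]]
    ball_subset_cball by blast
  moreover have "inj_on h (ball 0 1)"
    using embedding_map_inj_on[OF h(1)] ball_subset_cball inj_on_subset by blast
  ultimately show ?thesis using invariance_of_domain_surface[OF surf open_ball] h(2) by blast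
qed

end

section \<open>Every edge is on exactly two faces\<close>

context surface_triangulated
begin

text \<open>In a disc that parametrizes a closed face, the parameters of the interior of a side form an open
  subset of the circle. This gives room for gluing along the side.\<close>
lemma disc_at_side:
  assumes F: "F \<in> faces S V E" and e: "e \<in> sides F"
  obtains h where "embedding_map (top_of_set disc) S h" "h ` ball 0 1 = F" "e \<subseteq> h ` circle"
    "openin (top_of_set circle) {s \<in> circle. h s \<in> e - V}"
proof (rule face_boundary[OF F])
  fix h u v w a b c
  assume h: "embedding_map (top_of_set disc) S h" "h ` ball 0 1 = F" "h ` circle = a \<union> b \<union> c"
    and s: "sides F = {a, b, c}"
  have abc: "a \<in> E" "b \<in> E" "c \<in> E" using s unfolding sides_def by blast+
  have eE: "e \<in> E" using e s abc by auto
  \<comment> \<open>Points of the circle go to the graph, where the open set \<open>star e\<close> cuts out the interior of \<open>e\<close>.\<close>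
  have "h s \<in> e - V \<longleftrightarrow> h s \<in> star e" if "s \<in> circle" for s
  proof -
    have "h s \<in> a \<union> b \<union> c" using that h(3) by blast
    then show ?thesis
      using edge_minus_vertices_star[OF eE] abc unfolding star_def by blast
  qed
  then have "{s \<in> circle. h s \<in> e - V} = {s \<in> circle. h s \<in> star e}" by blast
  moreover have "continuous_map (top_of_set circle) S h"
    using continuous_map_from_subtopology_mono[OF embedding_map_continuous[OF h(1)]]
    sphere_cball by blast
  from openin_continuous_map_preimage[OF this open_star]
  have "openin (top_of_set circle) {s \<in> circle. h s \<in> star e}" by simp
  ultimately show thesis using that[OF h(1,2)] e s h(3) by auto
qed

text \<open>Let \<open>h1\<close> and \<open>h2\<close> parametrize the two closed faces. On the open cone \<open>K\<close> over the parameters of the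
  interior of \<open>e\<close> in the first disc, use \<open>h1\<close> inside the unit circle. Outside it, invert at the
  circle and use \<open>h2\<close>, after the direction has been carried over to the second disc by
  \<open>\<tau>\<close>, which is \<open>h1\<close> followed by the inverse of \<open>h2\<close>. The two definitions agree on the circle, and the result is injective since
  the faces are disjoint; so its image is open.\<close>
lemma glued_faces_neighborhood:
  assumes F: "F \<in> faces S V E" and G: "G \<in> faces S V E" and FG: "F \<noteq> G"
    and e: "e \<in> sides F" "e \<in> sides G"
  obtains N where "openin S N" "e - V \<subseteq> N" "N \<subseteq> F \<union> G \<union> e"
proof -
  have eE: "e \<in> E" using e unfolding sides_def by blast
  obtain h1 where h1: "embedding_map (top_of_set disc) S h1" "h1 ` ball 0 1 = F" "e \<subseteq> h1 ` circle"
    "openin (top_of_set circle) {s \<in> circle. h1 s \<in> e - V}" by (rule disc_at_side[OF F e(1)])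
  obtain h2 where h2: "embedding_map (top_of_set disc) S h2" "h2 ` ball 0 1 = G" "e \<subseteq> h2 ` circle"
    "openin (top_of_set circle) {s \<in> circle. h2 s \<in> e - V}" by (rule disc_at_side[OF G e(2)])
  obtain \<kappa> where \<kappa>: "homeomorphic_maps (top_of_set disc) (subtopology S (h2 ` disc)) h2 \<kappa>"
    using h2(1) unfolding embedding_map_def homeomorphic_map_maps by auto
  have left: "\<kappa> (h2 s) = s" if "s \<in> disc" for s
    using \<kappa> that unfolding homeomorphic_maps_def by auto
  have inj1: "inj_on h1 disc" and inj2: "inj_on h2 disc"
    using embedding_map_inj_on h1(1) h2(1) by auto
  define K where "K = {z :: real^2. z \<noteq> 0 \<and> h1 (sgn z) \<in> e - V}"
  have sgn_circle: "sgn z \<in> circle" if "z \<in> K" for z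
    using that unfolding K_def by (simp add: norm_sgn)
  have K: "open K"
  proof -
    obtain O' where O': "open O'" "{s \<in> circle. h1 s \<in> e - V} = circle \<inter> O'"
      using h1(4) unfolding openin_open by blast
    have "h1 (sgn z) \<in> e - V \<longleftrightarrow> sgn z \<in> O'" if "z \<noteq> 0" for z :: "real^2"
    proof -
      have "sgn z \<in> circle" using that by (simp add: norm_sgn)
      then show ?thesis using O'(2) by blast
    qed
    then have "K = (- {0}) \<inter> sgn -` O'" unfolding K_def by auto
    moreover have "continuous_on (- {0}) (sgn :: real^2 \<Rightarrow> real^2)"
      by (intro continuous_intros) auto
    ultimately show ?thesis
      using O'(1) by (simp add: continuous_open_preimage open_Compl)
  qed
  define \<tau> where "\<tau> z = \<kappa> (h1 (sgn z))" for z
  have \<tau>: "\<tau> z \<in> circle" "h2 (\<tau> z) = h1 (sgn z)" if "z \<in> K" for z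
  proof -
    have "h1 (sgn z) \<in> e" using that unfolding K_def by blast
    then obtain s where s: "s \<in> circle" "h1 (sgn z) = h2 s" using h2(3) by blast
    moreover have "\<kappa> (h2 s) = s" using left s(1) by simp
    ultimately show "\<tau> z \<in> circle" "h2 (\<tau> z) = h1 (sgn z)" unfolding \<tau>_def by auto
  qed
  have cont_\<tau>: "continuous_on K \<tau>"
  proof -
    have "continuous_on K sgn" unfolding K_def by (intro continuous_intros) auto
    then have "continuous_map (top_of_set K) (top_of_set disc) sgn"
      using sgn_circle by (auto simp: continuous_map_in_subtopology)
    then have "continuous_map (top_of_set K) S (h1 \<circ> sgn)"
      using embedding_map_continuous[OF h1(1)] continuous_map_compose by blast
    moreover have "h1 (sgn z) \<in> h2 ` disc" if "z \<in> K" for z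
      using \<tau>[OF that] by (metis image_eqI sphere_cball subsetD)
    ultimately have "continuous_map (top_of_set K) (subtopology S (h2 ` disc)) (h1 \<circ> sgn)"
      by (auto simp: continuous_map_in_subtopology)
    then have "continuous_map (top_of_set K) (top_of_set disc) (\<kappa> \<circ> (h1 \<circ> sgn))"
      using \<kappa> continuous_map_compose unfolding homeomorphic_maps_def by blast
    moreover have "\<kappa> \<circ> (h1 \<circ> sgn) = \<tau>" unfolding \<tau>_def by auto
    ultimately show ?thesis by (simp add: continuous_map_in_subtopology)
  qed
  define outer where "outer z = \<tau> z /\<^sub>R norm z" for z
  have norm_outer: "norm (outer z) = 1 / norm z" if "z \<in> K" for z
    using \<tau>(1)[OF that] unfolding outer_def by (simp add: divide_inverse)
  define \<phi> where "\<phi> z = (if norm z \<le> 1 then h1 z else h2 (outer z))" for z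
  have unit: "h1 z = h1 (sgn z)" "outer z = \<tau> z" if "norm z = 1" for z
    using that unfolding outer_def by (auto simp: sgn_div_norm)
  have cont: "continuous_map (top_of_set K) S \<phi>"
    unfolding \<phi>_def
  proof (rule continuous_map_cases_le)
    show "continuous_map (top_of_set K) euclideanreal norm" "continuous_map (top_of_set K) euclideanreal (\<lambda>z. 1)"
      by (auto intro!: continuous_intros)
    have "{z \<in> topspace (top_of_set K). norm z \<le> 1} \<subseteq> disc" by auto
    then show "continuous_map (subtopology (top_of_set K) {z \<in> topspace (top_of_set K). norm z \<le> 1}) S h1"
      using continuous_map_from_subtopology_mono[OF embedding_map_continuous[OF h1(1)]]
      by (simp add: subtopology_subtopology inf.absorb2)
    let ?O = "{z \<in> K. 1 \<le> norm z}"
    have "continuous_on ?O outer"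
      unfolding outer_def
      by (intro continuous_intros continuous_on_subset[OF cont_\<tau>]) (auto simp: K_def)
    moreover have "outer z \<in> disc" if "z \<in> ?O" for z
      using norm_outer[of z] that by (auto simp: divide_le_eq_1)
    ultimately have "continuous_map (top_of_set ?O) (top_of_set disc) outer"
      by (auto simp: continuous_map_in_subtopology)
    then have "continuous_map (top_of_set ?O) S (h2 \<circ> outer)"
      using embedding_map_continuous[OF h2(1)] continuous_map_compose by blast
    then show "continuous_map (subtopology (top_of_set K) {z \<in> topspace (top_of_set K). 1 \<le> norm z}) S (\<lambda>z. h2 (outer z))"
      by (simp add: subtopology_subtopology inf.absorb2 o_def)
    show "h1 z = h2 (outer z)" if "z \<in> topspace (top_of_set K)" "norm z = 1" for z
      using unit[OF that(2)] \<tau>(2)[of z] that(1) by simp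
  qed
  have inside: "\<phi> z \<in> F \<union> (e - V)" if "z \<in> K" "norm z \<le> 1" for z
  proof (cases "norm z = 1")
    case True then show ?thesis using unit that unfolding \<phi>_def K_def by auto
  next
    case False then have "z \<in> ball 0 1" using that by simp
    then show ?thesis using that h1(2) unfolding \<phi>_def by auto
  qed
  have outside: "\<phi> z \<in> G" if "z \<in> K" "\<not> norm z \<le> 1" for z
  proof -
    have "outer z \<in> ball 0 1" using norm_outer[of z] that by (auto simp: divide_less_eq_1)
    then show ?thesis using that h2(2) unfolding \<phi>_def by auto
  qed
  have disj: "(F \<union> (e - V)) \<inter> G = {}"
    using faces_disjoint[OF F G FG] face_avoids(2)[OF G eE] by blast
  have inj: "inj_on \<phi> K"
  proof (rule inj_onI)
    fix z w assume zw: "z \<in> K" "w \<in> K" "\<phi> z = \<phi> w"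
    have eq: "norm z \<le> 1 \<longleftrightarrow> norm w \<le> 1"
      using inside outside disj zw by (metis IntI emptyE)
    show "z = w"
    proof (cases "norm z \<le> 1")
      case True
      then show ?thesis using eq zw inj_onD[OF inj1, of z w] unfolding \<phi>_def by simp
    next
      case False
      then have big: "norm z > 1" "norm w > 1" using eq by auto
      then have d: "outer z \<in> disc" "outer w \<in> disc"
        using norm_outer[of z] norm_outer[of w] zw by (auto simp: divide_le_eq_1)
      have "h2 (outer z) = h2 (outer w)" using zw(3) big unfolding \<phi>_def by simp
      then have o: "outer z = outer w" using inj_onD[OF inj2] d by blast
      then have n: "norm z = norm w" using norm_outer[OF zw(1)] norm_outer[OF zw(2)] big by simp
      then have "\<tau> z = \<tau> w" using o big unfolding outer_def by auto
      then have "h1 (sgn z) = h1 (sgn w)" using \<tau>(2) zw by metis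
      then have "sgn z = sgn w"
        using inj_onD[OF inj1, of "sgn z" "sgn w"] sgn_circle zw by auto
      moreover have "norm x *\<^sub>R sgn x = x" for x :: "real^2"
        by (cases "x = 0") (simp_all add: sgn_div_norm)
      ultimately show ?thesis using n by metis
    qed
  qed
  show thesis
  proof
    show "openin S (\<phi> ` K)" by (rule invariance_of_domain_surface[OF surf K cont inj])
    show "e - V \<subseteq> \<phi> ` K"
    proof
      fix p assume p: "p \<in> e - V"
      then obtain s where s: "s \<in> circle" "p = h1 s" using h1(3) by blast
      then have "sgn s = s" "s \<noteq> 0" by (auto simp: sgn_div_norm)
      then have "s \<in> K" using p s unfolding K_def by simp
      moreover have "\<phi> s = p" using s unfolding \<phi>_def by simp
      ultimately show "p \<in> \<phi> ` K" by blast
    qed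
    show "\<phi> ` K \<subseteq> F \<union> G \<union> e" using inside outside by blast
  qed
qed

text \<open>A third face would accumulate at the interior of \<open>e\<close>, where the first two already fill a
  neighborhood.\<close>
lemma at_most_two_faces:
  assumes e: "e \<in> E"
  shows "finite {F \<in> faces S V E. e \<in> sides F} \<and> card {F \<in> faces S V E. e \<in> sides F} \<le> 2"
proof (rule ccontr)
  let ?X = "{F \<in> faces S V E. e \<in> sides F}"
  assume "\<not> (finite ?X \<and> card ?X \<le> 2)"
  then have more: "infinite ?X \<or> 3 \<le> card ?X" by linarith
  have "\<exists>Y. Y \<subseteq> ?X \<and> card Y = 3"
  proof (cases "finite ?X")
    case True
    then have "3 \<le> card ?X" using more by blast
    then obtain Y where "Y \<subseteq> ?X" "card Y = 3" "finite Y" by (rule obtain_subset_with_card_n)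
    then show ?thesis by (intro exI conjI)
  next
    case False
    show ?thesis using infinite_arbitrarily_large[OF False, of 3] by (elim exE conjE) (intro exI conjI)
  qed
  then obtain Y where Y: "Y \<subseteq> ?X" "card Y = 3" by (elim exE conjE)
  then obtain F G H where "Y = {F, G, H}" and ne: "F \<noteq> G" "F \<noteq> H" "G \<noteq> H"
    unfolding card_3_iff by (elim exE conjE) (rule that)
  then have F: "F \<in> faces S V E" "e \<in> sides F" and G: "G \<in> faces S V E" "e \<in> sides G"
    and H: "H \<in> faces S V E" "e \<in> sides H" using Y(1) by auto
  obtain N where N: "openin S N" "e - V \<subseteq> N" "N \<subseteq> F \<union> G \<union> e"
    by (rule glued_faces_neighborhood[OF F(1) G(1) ne(1) F(2) G(2)])
  obtain p where p: "p \<in> e" "p \<notin> V" using edge_interior[OF e] .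
  then have "p \<in> S closure_of H" "p \<in> N" using H(2) N(2) unfolding sides_def by auto
  then have "N \<inter> H \<noteq> {}" using N(1) unfolding in_closure_of by blast
  then show False
    using N(3) faces_disjoint[OF F(1) H(1) ne(2)] faces_disjoint[OF G(1) H(1) ne(3)]
      face_avoids(2)[OF H(1) e] by blast
qed

text \<open>Each face has a side among the finitely many edges, and an edge serves at most two faces.\<close>
lemma finite_faces: "finite (faces S V E)"
proof -
  have "F \<in> (\<Union>e\<in>E. {F \<in> faces S V E. e \<in> sides F})" if F: "F \<in> faces S V E" for F
  proof (rule face_boundary[OF F])
    fix e f g assume "sides F = {e, f, g}"
    then have "e \<in> sides F" "e \<in> E" unfolding sides_def by blast+
    then show ?thesis using F by blast
  qed
  then have "faces S V E \<subseteq> (\<Union>e\<in>E. {F \<in> faces S V E. e \<in> sides F})" by blast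
  then show ?thesis using at_most_two_faces finite_E by (meson finite_UN finite_subset)
qed

text \<open>The arc can be parametrized by a segment in the plane, and a segment has no interior points.\<close>
lemma arc_no_neighborhood:
  assumes j: "joins S e u v" and W: "openin S W" "W \<subseteq> e"
  shows "W = {}"
proof (rule ccontr)
  assume "W \<noteq> {}"
  then obtain p where p: "p \<in> W" by blast
  obtain g where g: "embedding_map (top_of_set {0..1::real}) S g" "g ` {0..1} = e"
    using j unfolding joins_def by blast
  define b :: "real^2" where "b = axis 1 1"
  have bb: "b \<bullet> b = 1" unfolding b_def by (simp add: inner_axis_axis)
  define A where "A = (\<lambda>t. t *\<^sub>R b) ` {0..1}"
  have "homeomorphic_maps (top_of_set A) (top_of_set {0..1}) (\<lambda>z. z \<bullet> b) (\<lambda>t. t *\<^sub>R b)"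
    unfolding homeomorphic_maps_def A_def
    by (auto simp: continuous_map_in_subtopology bb intro!: continuous_intros)
  then have "homeomorphic_map (top_of_set A) (top_of_set {0..1}) (\<lambda>z. z \<bullet> b)"
    using homeomorphic_map_maps by blast
  then have "embedding_map (top_of_set A) (top_of_set {0..1::real}) (\<lambda>z. z \<bullet> b)"
    using surjective_embedding_map by blast
  then have emb: "embedding_map (top_of_set A) S (g \<circ> (\<lambda>z. z \<bullet> b))"
    using g(1) embedding_map_compose by blast
  have im: "(g \<circ> (\<lambda>z. z \<bullet> b)) ` A = e"
    unfolding A_def image_comp[symmetric] image_image using g(2) bb by simp
  then obtain a where "a \<in> A" "(g \<circ> (\<lambda>z. z \<bullet> b)) a = p" using p W(2) by blast
  then have "a \<in> interior A"
    using embedding_neighborhood_interior[OF surf emb _ W(1)] p W(2) im by blast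
  moreover have "interior A = {}"
  proof (rule empty_interior_lowdim)
    have "A \<subseteq> span {b}" unfolding A_def by (auto intro: span_mul span_base)
    then have "dim A \<le> card {b}" by (intro dim_le_card) auto
    then show "dim A < DIM(real^2)" by simp
  qed
  ultimately show False by blast
qed

text \<open>As there are only finitely many faces, a point \<open>p\<close> in the interior of \<open>e\<close> has a neighborhood \<open>W\<close>
  that meets no face except those that have \<open>e\<close> as a side. If there is none, \<open>W\<close> lies in the arc \<open>e\<close>.
  If there is one, \<open>W\<close> lies in its closed disc, where \<open>p\<close> is on the bounding circle.\<close>
lemma exactly_two_faces:
  assumes e: "e \<in> E"
  shows "card {F \<in> faces S V E. e \<in> sides F} = 2"
proof (rule ccontr)
  let ?X = "{F \<in> faces S V E. e \<in> sides F}"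
  assume "card ?X \<noteq> 2"
  then have "card ?X = 0 \<or> card ?X = 1" using at_most_two_faces[OF e] by linarith
  then have X: "?X = {} \<or> (\<exists>F. ?X = {F})"
  proof
    assume "card ?X = 0"
    then have "?X = {}" using card_0_eq[OF conjunct1[OF at_most_two_faces[OF e]]] by simp
    then show ?thesis by (rule disjI1)
  next
    assume "card ?X = 1"
    then obtain F where "?X = {F}" by (rule card_1_singletonE)
    then show ?thesis by (intro disjI2 exI)
  qed
  obtain p where p: "p \<in> e" "p \<notin> V" using edge_interior[OF e] .
  obtain u v where "u \<in> V" "v \<in> V" and j: "joins S e u v" and "e \<inter> V = {u, v}"
    by (rule edge_joins[OF e])
  define C where "C = (\<Union>F\<in>faces S V E - ?X. S closure_of F)"
  define W where "W = star e - C"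
  have "closedin S C" unfolding C_def using finite_faces by (intro closedin_Union) auto
  then have W: "openin S W" unfolding W_def using open_star openin_diff by blast
  have "p \<notin> C" unfolding C_def using side_of_face[OF _ e p] by blast
  then have pW: "p \<in> W" unfolding W_def using edge_minus_vertices_star[OF e] p by blast
  have "F \<subseteq> S closure_of F" if "F \<in> faces S V E" for F
    by (rule closure_of_subset[OF openin_subset[OF face_open[OF that]]])
  then have "F \<in> ?X" if "F \<in> faces S V E" "q \<in> F" "q \<notin> C" for F q
    using that unfolding C_def by blast
  then have sub: "W \<subseteq> e \<union> \<Union>?X" unfolding W_def using star_subset[of e] by blast
  from X show False
  proof
    assume empty: "?X = {}"
    have "W \<subseteq> e" using sub unfolding empty by simp
    then show False using arc_no_neighborhood[OF j W] pW by simp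
  next
    assume "\<exists>F. ?X = {F}"
    then obtain F where X: "?X = {F}" by blast
    then have F: "F \<in> faces S V E" "e \<in> sides F" by blast+
    obtain h where h: "embedding_map (top_of_set disc) S h" "h ` ball 0 1 = F" "e \<subseteq> h ` circle"
      "openin (top_of_set circle) {s \<in> circle. h s \<in> e - V}" by (rule disc_at_side[OF F])
    obtain s where s: "s \<in> circle" "h s = p" using h(3) p by blast
    have "W \<subseteq> h ` disc"
    proof -
      have "F \<subseteq> h ` disc" "e \<subseteq> h ` disc" using h(2,3) ball_subset_cball sphere_cball by blast+
      then show ?thesis using sub unfolding X by blast
    qed
    then have "s \<in> interior disc"
      using embedding_neighborhood_interior[OF surf h(1) _ W, of s] s pW by simp
    then show False using s(1) by simp
  qed
qed

end

section \<open>Local colorings of triangulated surfaces\<close>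

lemma two_subsets_of_three:
  assumes "u \<noteq> v" "v \<noteq> w" "w \<noteq> u"
  shows "{p. p \<subseteq> {u, v, w} \<and> card p = 2} = {{u, v}, {v, w}, {w, u}}"
proof
  show "{p. p \<subseteq> {u, v, w} \<and> card p = 2} \<subseteq> {{u, v}, {v, w}, {w, u}}"
  proof
    fix p assume "p \<in> {p. p \<subseteq> {u, v, w} \<and> card p = 2}"
    then have p: "p \<subseteq> {u, v, w}" "card p = 2" by auto
    then obtain a b where "p = {a, b}" "a \<noteq> b" unfolding card_2_iff by (elim exE conjE)
    then show "p \<in> {{u, v}, {v, w}, {w, u}}" using p(1) by (auto simp: insert_commute)
  qed
qed (use assms in auto)

context surface_triangulated
begin

lemma sides_bij_corner_pairs:
  assumes F: "F \<in> faces S V E"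
  shows "card (corners F) = 3 \<and> bij_betw (\<lambda>e. e \<inter> V) (sides F) {p. p \<subseteq> corners F \<and> card p = 2}"
proof (rule face_boundary[OF F])
  fix h u v w e f g
  assume s: "sides F = {e, f, g}" and c: "corners F = {u, v, w}"
    and ends: "e \<inter> V = {u, v}" "f \<inter> V = {v, w}" "g \<inter> V = {w, u}"
    and ne: "u \<noteq> v" "v \<noteq> w" "w \<noteq> u"
  have "bij_betw (\<lambda>e. e \<inter> V) {e, f, g} {{u, v}, {v, w}, {w, u}}"
    unfolding bij_betw_def inj_on_def using ends ne by (auto simp: doubleton_eq_iff)
  moreover have "card {u, v, w} = 3" using ne by simp
  ultimately show ?thesis unfolding s c two_subsets_of_three[OF ne] by blast
qed

sublocale combinatorial: closed_triangle_complex V E "faces S V E" "\<lambda>e. e \<inter> V" corners sides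
proof
  show "finite V" "finite E" "finite (faces S V E)" by (rule finite_V finite_E finite_faces)+
  show "e \<inter> V \<subseteq> V" for e by blast
  show "card (e \<inter> V) = 2" if e: "e \<in> E" for e
  proof -
    obtain u v where "u \<in> V" "v \<in> V" and j: "joins S e u v" and ev: "e \<inter> V = {u, v}"
      by (rule edge_joins[OF e])
    show ?thesis unfolding ev using joinsD(3)[OF j] by simp
  qed
  show "corners F \<subseteq> V" for F unfolding corners_def by blast
  show "sides F \<subseteq> E" for F unfolding sides_def by blast
  show "card (corners F) = 3" "bij_betw (\<lambda>e. e \<inter> V) (sides F) {p. p \<subseteq> corners F \<and> card p = 2}"
    if "F \<in> faces S V E" for F
    using sides_bij_corner_pairs[OF that] by auto
  show "card {F \<in> faces S V E. e \<in> sides F} = 2" if "e \<in> E" for e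
    by (rule exactly_two_faces[OF that])
qed

lemma degree_eq: "v \<in> V \<Longrightarrow> combinatorial.degree v = edge_degree E v"
  unfolding combinatorial.degree_def edge_degree_def by simp

lemma adjacent_distinct: "adjacent S E u v \<Longrightarrow> u \<noteq> v"
  unfolding adjacent_def using joinsD(3) by metis

text \<open>The arc of an edge may be traversed from either end, so adjacency is a property of the set of
  ends.\<close>
lemma adjacent_iff:
  assumes "u \<in> V" "v \<in> V"
  shows "adjacent S E u v \<longleftrightarrow> (\<exists>e\<in>E. e \<inter> V = {u, v} \<and> u \<noteq> v)"
proof
  assume a: "adjacent S E u v"
  then obtain e where e: "e \<in> E" "joins S e u v" unfolding adjacent_def by blast
  then show "\<exists>e\<in>E. e \<inter> V = {u, v} \<and> u \<noteq> v"
    using edge_ends[OF e assms] adjacent_distinct[OF a] by blast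
next
  assume "\<exists>e\<in>E. e \<inter> V = {u, v} \<and> u \<noteq> v"
  then obtain e where e: "e \<in> E" "e \<inter> V = {u, v}" by blast
  obtain a b where "a \<in> V" "b \<in> V" and j: "joins S e a b" and ab: "e \<inter> V = {a, b}"
    by (rule edge_joins[OF e(1)])
  have "a = u \<and> b = v \<or> a = v \<and> b = u" using e(2) ab by (auto simp: doubleton_eq_iff)
  then have "joins S e u v" using j joins_sym by metis
  then show "adjacent S E u v" using e(1) unfolding adjacent_def by blast
qed

text \<open>This links palettes, which are built from the edges at a vertex, with sets of neighbors. The vertex
  itself is included on both sides, because on the left it lies in every edge at \<open>v\<close>.\<close>
lemma closed_neighborhood:
  assumes v: "v \<in> V"
  shows "insert v (\<Union>{e \<inter> V |e. e \<in> E \<and> v \<in> e \<inter> V}) = insert v (nbrs V (adjacent S E) v)"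
proof
  show "insert v (nbrs V (adjacent S E) v) \<subseteq> insert v (\<Union>{e \<inter> V |e. e \<in> E \<and> v \<in> e \<inter> V})"
  proof
    fix u assume u: "u \<in> insert v (nbrs V (adjacent S E) v)"
    show "u \<in> insert v (\<Union>{e \<inter> V |e. e \<in> E \<and> v \<in> e \<inter> V})"
    proof (cases "u = v")
      case False
      then obtain e where "e \<in> E" "e \<inter> V = {v, u}"
        using u adjacent_iff[OF v] unfolding nbrs_def by blast
      then show ?thesis by blast
    qed simp
  qed
  show "insert v (\<Union>{e \<inter> V |e. e \<in> E \<and> v \<in> e \<inter> V}) \<subseteq> insert v (nbrs V (adjacent S E) v)"
  proof
    fix u assume u: "u \<in> insert v (\<Union>{e \<inter> V |e. e \<in> E \<and> v \<in> e \<inter> V})"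
    show "u \<in> insert v (nbrs V (adjacent S E) v)"
    proof (cases "u = v")
      case False
      then obtain e where e: "e \<in> E" "v \<in> e \<inter> V" "u \<in> e \<inter> V" using u by blast
      obtain z where "z \<noteq> v" "e \<inter> V = {v, z}" "z \<in> V" by (rule combinatorial.ends_at[OF e(1,2)])
      then have "e \<inter> V = {v, u}" using e(3) False by auto
      then show ?thesis using adjacent_iff[OF v] e False unfolding nbrs_def by blast
    qed simp
  qed
qed

text \<open>For a proper coloring the colors of the neighbors of \<open>v\<close> form the palette of \<open>v\<close> without the
  color of \<open>v\<close>, so color and palette determine them.\<close>
theorem local_four_coloring:
  fixes c :: "'a \<Rightarrow> 'c"
  assumes col: "local_coloring V (adjacent S E) 4 c"
    and xy: "x \<in> V" "y \<in> V" "x \<noteq> y" "odd (edge_degree E x)" "odd (edge_degree E y)"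
    and even: "\<And>v. v \<in> V \<Longrightarrow> v \<noteq> x \<Longrightarrow> v \<noteq> y \<Longrightarrow> even (edge_degree E v)"
  shows "c x = c y"
    and "c ` nbrs V (adjacent S E) x = c ` nbrs V (adjacent S E) y"
    and "card (c ` nbrs V (adjacent S E) x) = 3"
proof -
  have adjacent_colors: "c u \<noteq> c v" if "u \<in> V" "v \<in> V" "adjacent S E u v" for u v
    using col that unfolding local_coloring_def proper_coloring_def by blast
  have few: "card (c ` nbrs V (adjacent S E) v) \<le> 3" if "v \<in> V" for v
    using col that unfolding local_coloring_def by simp
  interpret colored_triangle_complex V E "faces S V E" "\<lambda>e. e \<inter> V" corners sides c
  proof
    fix e assume e: "e \<in> E"
    obtain u v where uv: "u \<in> V" "v \<in> V" and j: "joins S e u v" and ev: "e \<inter> V = {u, v}"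
      by (rule edge_joins[OF e])
    have "c u \<noteq> c v" using adjacent_colors[OF uv] e j unfolding adjacent_def by blast
    then show "inj_on c (e \<inter> V)" unfolding ev inj_on_def by auto
  qed
  have pal: "palette v = insert (c v) (c ` nbrs V (adjacent S E) v)" if "v \<in> V" for v
    unfolding palette_def using arg_cong[OF closed_neighborhood[OF that], of "image c"] by simp
  have nb: "c ` nbrs V (adjacent S E) v = palette v - {c v}" if "v \<in> V" for v
  proof -
    have "c v \<notin> c ` nbrs V (adjacent S E) v"
      using adjacent_colors[OF that] unfolding nbrs_def by fastforce
    then show ?thesis unfolding pal[OF that] by simp
  qed
  interpret locally_four_colored_complex V E "faces S V E" "\<lambda>e. e \<inter> V" corners sides c
  proof
    fix v assume v: "v \<in> V"
    then show "card (palette v) \<le> 4"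
      unfolding pal[OF v] using few[OF v] card_insert_le_m1[of 4 "c ` nbrs V (adjacent S E) v" "c v"] by simp
  qed
  have *: "c x = c y \<and> palette x = palette y \<and> card (palette x) = 4"
    by (rule two_odd_vertices[OF xy(1,2)]) (use xy even degree_eq in simp_all)
  then show "c x = c y" by blast
  show "c ` nbrs V (adjacent S E) x = c ` nbrs V (adjacent S E) y"
    unfolding nb[OF xy(1)] nb[OF xy(2)] using * by simp
  have "c x \<in> palette x" unfolding palette_def by simp
  then have "card (palette x - {c x}) = card (palette x) - 1" by (rule card_Diff_singleton)
  then show "card (c ` nbrs V (adjacent S E) x) = 3"
    unfolding nb[OF xy(1)] using * by linarith
qed

text \<open>This makes the minimum in the local chromatic number one that is attained. A coloring with pairwise
  distinct colors will do.\<close>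
lemma local_coloring_exists: "\<exists>k. \<exists>c :: 'a \<Rightarrow> nat. local_coloring V (adjacent S E) k c"
proof -
  obtain c :: "'a \<Rightarrow> nat" where c: "inj_on c V"
    using finite_imp_inj_to_nat_seg[OF finite_V] by metis
  have "local_coloring V (adjacent S E) (Suc (card V)) c"
    unfolding local_coloring_def proper_coloring_def
  proof (intro conjI ballI impI)
    fix u v assume "u \<in> V" "v \<in> V" "adjacent S E u v"
    then show "c u \<noteq> c v" using inj_onD[OF c, of u v] adjacent_distinct by metis
  next
    fix v
    have "nbrs V (adjacent S E) v \<subseteq> V" unfolding nbrs_def by blast
    then have "card (nbrs V (adjacent S E) v) \<le> card V" by (rule card_mono[OF finite_V])
    moreover have "card (c ` nbrs V (adjacent S E) v) \<le> card (nbrs V (adjacent S E) v)"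
      by (rule card_image_le) (simp add: nbrs_def finite_V)
    ultimately show "card (c ` nbrs V (adjacent S E) v) \<le> Suc (card V) - 1" by simp
  qed simp
  then show ?thesis by blast
qed

end

lemma local_coloring_mono:
  "local_coloring V adj k c \<Longrightarrow> k \<le> l \<Longrightarrow> local_coloring V adj l c"
  unfolding local_coloring_def by fastforce

theorem theorem7p2:
  fixes S :: "'a topology" and V :: "'a set" and E :: "'a set set" and x y :: 'a
  assumes "surface_triangulation S V E"
    and "x \<in> V" and "y \<in> V" and "x \<noteq> y"
    and "odd (edge_degree E x)" and "odd (edge_degree E y)"
    and "\<And>v. v \<in> V \<Longrightarrow> v \<noteq> x \<Longrightarrow> v \<noteq> y \<Longrightarrow> even (edge_degree E v)"
  shows "(\<forall>c :: 'a \<Rightarrow> 'c. local_coloring V (adjacent S E) 4 c \<longrightarrow>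
            c x = c y \<and>
            c ` nbrs V (adjacent S E) x = c ` nbrs V (adjacent S E) y \<and>
            card (c ` nbrs V (adjacent S E) x) = 3) \<and>
         (adjacent S E x y \<longrightarrow> local_chromatic_number V (adjacent S E) \<ge> 5)"
proof -
  interpret surface_triangulated S V E by (unfold_locales) (rule assms(1))
  show ?thesis
  proof (intro conjI allI impI)
    fix c :: "'a \<Rightarrow> 'c"
    assume col: "local_coloring V (adjacent S E) 4 c"
    show "c x = c y" "c ` nbrs V (adjacent S E) x = c ` nbrs V (adjacent S E) y"
      "card (c ` nbrs V (adjacent S E) x) = 3"
      by (rule local_four_coloring[OF col assms(2-)]; assumption)+
  next
    assume adj: "adjacent S E x y"
    show "local_chromatic_number V (adjacent S E) \<ge> 5"
    proof (rule ccontr)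
      assume less: "\<not> local_chromatic_number V (adjacent S E) \<ge> 5"
      obtain c :: "'a \<Rightarrow> nat" where
        "local_coloring V (adjacent S E) (local_chromatic_number V (adjacent S E)) c"
        using LeastI_ex[OF local_coloring_exists] unfolding local_chromatic_number_def by (elim exE)
      then have col: "local_coloring V (adjacent S E) 4 c"
        by (rule local_coloring_mono) (use less in linarith)
      have "c x = c y" by (rule local_four_coloring(1)[OF col assms(2-)])
      moreover have "c x \<noteq> c y"
        using col adj assms(2,3) unfolding local_coloring_def proper_coloring_def by blast
      ultimately show False by blast
    qed
  qed
qed

end
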